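(* Let $\Sigma \subset \mathbb{R}^n$ be a $k$-dimensional smooth submanifold. For any initial chord $C_0: I \to \mathbb{R}^n$ with $C_0(\partial I) \subset \Sigma$, there exist an $\epsilon > 0$ and a smooth solution $C(u,t): I \times [0,\epsilon) \to \mathbb{R}^n$ to the chord shortening flow relative to $\Sigma$ with initial condition $C(\cdot,0) = C_0$. Moreover, the solution is unique.
   Context: Notation: $I = [0,1]$, $\partial I = \{0,1\}$; $\mathbb{R}^n$ carries the standard inner product and norm $|\cdot|$. Submanifolds are smooth and embedded, and may be disconnected. Chord: for distinct $p,q \in \Sigma$, $C_{p,q}$ is the oriented line segment from $p$ to $q$ in $\mathbb{R}^n$; a chord $C: I\to\mathbb{R}^n$ is the constant speed parametrization of such a segment (so its end points are distinct). The outward unit conormal $\eta$ of $C_{p,q}$ is defined at the end points by $\eta(p) = \frac{p-q}{|p-q|} = -\eta(q)$. For $x \in \Sigma$ and $v \in \mathbb{R}^n$, $v^T = \pi_x(v)$ where $\pi_x: \mathbb{R}^n \to T_x\Sigma$ is orthogonal projection; thus $\eta^T(p)=\pi_p(\eta(p))$, $\eta^T(q)=\pi_q(\eta(q))$. Chord shortening flow: a smooth family of curves $C(u,t): I \times [0,T) \to \mathbb{R}^n$ is a solution to the chord shortening flow (relative to $\Sigma$) if for all $t \in [0,T)$: (a) $p_t := C(0,t)$ and $q_t := C(1,t)$ lie on $\Sigma$; (b) $C(\cdot,t): I \to \mathbb{R}^n$ is a constant speed parametrization of $C_{p_t,q_t}$ (with $p_t\neq q_t$); (c) $\frac{\partial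 C}{\partial t}(0,t) = -\eta^T(C(0,t))$ and $\frac{\partial C}{\partial t}(1,t) = -\eta^T(C(1,t))$. *)

theory Defs
  imports "HOL-Analysis.Analysis"
begin

(* C^m on U: the iterated directional derivatives up to order m exist and are continuous.
   Only meaningful for open U, since derivatives are taken with respect to the full
   neighbourhood filter. *)
primrec Ck_on :: "nat \<Rightarrow> 'a::euclidean_space set \<Rightarrow> ('a \<Rightarrow> 'b::euclidean_space) \<Rightarrow> bool" where
  "Ck_on 0 U f \<longleftrightarrow> continuous_on U f"
| "Ck_on (Suc m) U f \<longleftrightarrow>
     (\<forall>x\<in>U. f differentiable (at x)) \<and>
     (\<forall>v. Ck_on m U (\<lambda>x. frechet_derivative f (at x) v))"

(* Smoothness on an arbitrary subset of a Euclidean space: f extends smoothly to a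
   neighbourhood of each point.  For open S this is C^infinity in the usual sense; for
   [0,1] x [0,T) it is smoothness up to the boundary. *)
definition smooth_on :: "'a::euclidean_space set \<Rightarrow> ('a \<Rightarrow> 'b::euclidean_space) \<Rightarrow> bool" where
  "smooth_on S f \<longleftrightarrow>
     (\<forall>x\<in>S. \<exists>U g. open U \<and> x \<in> U \<and> (\<forall>m. Ck_on m U g) \<and> (\<forall>y\<in>S \<inter> U. g y = f y))"

definition diffeomorphism ::
    "'a::euclidean_space set \<Rightarrow> 'b::euclidean_space set \<Rightarrow> ('a \<Rightarrow> 'b) \<Rightarrow> ('b \<Rightarrow> 'a) \<Rightarrow> bool" where
  "diffeomorphism U V \<phi> \<psi> \<longleftrightarrow> homeomorphism U V \<phi> \<psi> \<and> smooth_on U \<phi> \<and> smooth_on V \<psi>"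

(* Embedded submanifold, by slice charts of the ambient space; a k-dimensional linear
   subspace L plays the role of R^k x {0}. *)
definition smooth_submanifold :: "nat \<Rightarrow> 'a::euclidean_space set \<Rightarrow> bool" where
  "smooth_submanifold k \<Sigma> \<longleftrightarrow>
     (\<forall>x\<in>\<Sigma>. \<exists>U V \<phi> \<psi> L.
        open U \<and> x \<in> U \<and> open V \<and> diffeomorphism U V \<phi> \<psi> \<and>
        subspace (L :: 'a set) \<and> dim L = k \<and> \<phi> ` (U \<inter> \<Sigma>) = V \<inter> L)"

(* Velocities at x of smooth curves in \<Sigma>. *)
definition tangent_space :: "'a::euclidean_space set \<Rightarrow> 'a \<Rightarrow> 'a set" where
  "tangent_space \<Sigma> x =
     {v. \<exists>\<delta>>0. \<exists>\<gamma>. smooth_on {-\<delta><..<\<delta>} \<gamma> \<and> \<gamma> ` {-\<delta><..<\<delta>} \<subseteq> \<Sigma> \<and>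
           \<gamma> (0::real) = x \<and> (\<gamma> has_vector_derivative v) (at 0)}"

(* Only meaningful when W is a linear subspace. *)
definition orthogonal_projection :: "'a::euclidean_space set \<Rightarrow> 'a \<Rightarrow> 'a" where
  "orthogonal_projection W v = (THE w. w \<in> W \<and> (\<forall>y\<in>W. orthogonal (v - w) y))"

definition tangential_part :: "'a::euclidean_space set \<Rightarrow> 'a \<Rightarrow> 'a \<Rightarrow> 'a" where
  "tangential_part \<Sigma> x v = orthogonal_projection (tangent_space \<Sigma> x) v"

(* Conormal at the first argument p of the segment with end points p and q.
   The one at q is conormal q p, which equals -conormal p q. *)
definition conormal :: "'a::euclidean_space \<Rightarrow> 'a \<Rightarrow> 'a" where
  "conormal p q = (p - q) /\<^sub>R norm (p - q)"

(* linepath p q is the constant speed parametrization, over [0,1], of the oriented segment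
   from p to q.  Values of C outside [0,1] are irrelevant. *)
definition chord_between :: "'a::euclidean_space \<Rightarrow> 'a \<Rightarrow> (real \<Rightarrow> 'a) \<Rightarrow> bool" where
  "chord_between p q C \<longleftrightarrow> p \<noteq> q \<and> (\<forall>u\<in>{0..1}. C u = linepath p q u)"

definition chord :: "(real \<Rightarrow> 'a::euclidean_space) \<Rightarrow> bool" where
  "chord C \<longleftrightarrow> (\<exists>p q. chord_between p q C)"

(* Only the values C u t with u in [0,1] and t in [0,T) matter; the time derivative at
   t = 0 is the one-sided one. *)
definition chord_shortening_flow ::
    "'a::euclidean_space set \<Rightarrow> real \<Rightarrow> (real \<Rightarrow> real \<Rightarrow> 'a) \<Rightarrow> bool" where
  "chord_shortening_flow \<Sigma> T C \<longleftrightarrow>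
     smooth_on ({0..1} \<times> {0..<T}) (\<lambda>(u, t). C u t) \<and>
     (\<forall>t\<in>{0..<T}.
        C 0 t \<in> \<Sigma> \<and> C 1 t \<in> \<Sigma> \<and>
        chord_between (C 0 t) (C 1 t) (\<lambda>u. C u t) \<and>
        (C 0 has_vector_derivative - tangential_part \<Sigma> (C 0 t) (conormal (C 0 t) (C 1 t)))
          (at t within {0..<T}) \<and>
        (C 1 has_vector_derivative - tangential_part \<Sigma> (C 1 t) (conormal (C 1 t) (C 0 t)))
          (at t within {0..<T}))"

end

theory Submission
  imports Defs
begin

text \<open>
  A chord is determined by its end points, so the chord shortening flow is the ordinary
  differential equation \<open>z' = chord_field \<Sigma> z\<close> for the pair of end points, on the set of pairs of
  distinct points of \<open>\<Sigma>\<close>. The field has a meaning only on this set, which need not be open, and involves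
  the orthogonal projections onto the varying tangent spaces, whose smoothness has to be shown. One
  local construction settles both.

  In a slice chart \<open>\<phi>\<close> with inverse \<open>\<psi>\<close> and slice \<open>L\<close>, the tangent space at \<open>x \<in> \<Sigma>\<close> is
  \<open>D\<psi>(\<phi> x) L\<close> (\<open>tangent_space_eq\<close>). This subspace makes sense for every \<open>x\<close> in the chart domain,
  on \<open>\<Sigma>\<close> or not, and the projection onto it depends smoothly on \<open>x\<close> by Gram-Schmidt
  (\<open>Ck_on_orthogonal_projection\<close>). Replacing the tangential projections at the two end points by
  these projections extends \<open>chord_field\<close> to a smooth field on an open set of pairs
  (\<open>Ck_extended_field\<close>), and Picard iteration gives a solution of the extended equation (\<open>picard_lindelof_existence\<close>). It does
  not leave \<open>\<Sigma>\<close>: the chart carries the velocities into \<open>L\<close>, so the image of an end point moves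
  inside \<open>L\<close> as soon as it starts there (\<open>curve_stays_in\<close>). Differentiating the equation repeatedly
  shows that the solution is smooth in time (\<open>Ck_on_ode_solution\<close>), and the straight segment between
  smooth end points is smooth in both variables.

  For uniqueness, the extension shows that \<open>chord_field\<close> is locally Lipschitz on the
  pairs of distinct points of \<open>\<Sigma>\<close>. Hence the set of times at which two solutions agree is open as well as closed
  (\<open>ode_solution_unique\<close>).
\<close>

section \<open>Calculus of continuously differentiable maps\<close>

lemma Ck_on_has_derivative:
  assumes "Ck_on (Suc m) U f" "x \<in> U"
  shows "(f has_derivative frechet_derivative f (at x)) (at x)"
  using assms frechet_derivative_works[of f "at x"] by simp

lemma Ck_on_cong:
  fixes f g :: "'a::euclidean_space \<Rightarrow> 'b::euclidean_space"
  assumes "open U" "\<And>x. x \<in> U \<Longrightarrow> f x = g x"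
  shows "Ck_on m U f \<longleftrightarrow> Ck_on m U g"
  using assms(2)
proof (induction m arbitrary: f g)
  case 0
  then show ?case by (simp cong: continuous_on_cong)
next
  case (Suc m)
  have *: "Ck_on (Suc m) U g" if "Ck_on (Suc m) U f" and eq: "\<And>x. x \<in> U \<Longrightarrow> f x = g x"
    for f g :: "'a \<Rightarrow> 'b"
  proof -
    have d: "(g has_derivative frechet_derivative f (at x)) (at x)" if "x \<in> U" for x
      by (rule has_derivative_transform_within_open[OF _ \<open>open U\<close> that eq])
        (rule Ck_on_has_derivative[OF \<open>Ck_on (Suc m) U f\<close> that])
    then have "Ck_on m U (\<lambda>x. frechet_derivative g (at x) v)" for v
      using Suc.IH[of "\<lambda>x. frechet_derivative g (at x) v" "\<lambda>x. frechet_derivative f (at x) v"]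
        frechet_derivative_at[OF d] \<open>Ck_on (Suc m) U f\<close>
      by auto
    moreover have "\<forall>x\<in>U. g differentiable at x"
      using d differentiableI by blast
    ultimately show ?thesis by simp
  qed
  show ?case
  proof
    show "Ck_on (Suc m) U g" if "Ck_on (Suc m) U f"
      by (rule *[OF that Suc.prems])
    show "Ck_on (Suc m) U f" if "Ck_on (Suc m) U g"
      by (rule *[OF that Suc.prems[symmetric]])
  qed
qed

text \<open>The working form of the recursive clause: any formula for the derivative on \<open>U\<close> can be used in place
of the canonical one.\<close>

lemma Ck_on_SucI:
  assumes "open U" "\<And>x. x \<in> U \<Longrightarrow> (f has_derivative f' x) (at x)"
    and "\<And>v. Ck_on m U (\<lambda>x. f' x v)"
  shows "Ck_on (Suc m) U f"
proof -
  have "Ck_on m U (\<lambda>x. frechet_derivative f (at x) v)" for v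
    using assms(3)[of v] frechet_derivative_at[OF assms(2)]
    by (subst Ck_on_cong[OF assms(1), where g = "\<lambda>x. f' x v"]) simp_all
  moreover have "\<forall>x\<in>U. f differentiable at x"
    using assms(2) differentiableI by blast
  ultimately show ?thesis by simp
qed

lemma Ck_on_derivative: "Ck_on (Suc m) U f \<Longrightarrow> Ck_on m U (\<lambda>x. frechet_derivative f (at x) v)"
  by simp

lemma Ck_on_SucD: "Ck_on (Suc m) U f \<Longrightarrow> Ck_on m U f"
proof (induction m arbitrary: f)
  case 0
  then show ?case
    by (simp add: differentiable_imp_continuous_on differentiable_on_def
        differentiable_at_withinI)
next
  case (Suc m)
  then show ?case by (metis Ck_on.simps(2))
qed

lemma Ck_on_subset: "Ck_on m U f \<Longrightarrow> V \<subseteq> U \<Longrightarrow> Ck_on m V f"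
  by (induction m arbitrary: f) (auto intro: continuous_on_subset)

lemma Ck_on_locally:
  assumes "\<And>x. x \<in> S \<Longrightarrow> \<exists>U. open U \<and> x \<in> U \<and> Ck_on m U f"
  shows "Ck_on m S f"
  using assms
proof (induction m arbitrary: f)
  case 0
  then show ?case
    unfolding Ck_on.simps
    by (meson continuous_at_imp_continuous_on continuous_on_eq_continuous_at)
next
  case (Suc m)
  show ?case
    unfolding Ck_on.simps
  proof (intro conjI ballI allI)
    show "f differentiable at x" if "x \<in> S" for x
      using Suc.prems[OF that] by auto
    show "Ck_on m S (\<lambda>x. frechet_derivative f (at x) v)" for v
    proof (rule Suc.IH)
      show "\<exists>U. open U \<and> x \<in> U \<and> Ck_on m U (\<lambda>x. frechet_derivative f (at x) v)" if "x \<in> S" for x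
        using Suc.prems[OF that] by auto
    qed
  qed
qed

text \<open>On an open set the local smooth extensions in the definition of smoothness can be taken to be the
function itself, since being \<open>C\<^sup>m\<close> is a local property.\<close>

lemma smooth_on_open_iff:
  assumes "open S"
  shows "smooth_on S f \<longleftrightarrow> (\<forall>m. Ck_on m S f)"
proof
  assume f: "smooth_on S f"
  show "\<forall>m. Ck_on m S f"
  proof
    fix m
    show "Ck_on m S f"
    proof (rule Ck_on_locally)
      fix x assume "x \<in> S"
      then obtain U g where "open U" "x \<in> U" "\<forall>m. Ck_on m U g" "\<forall>y\<in>S \<inter> U. g y = f y"
        using f unfolding smooth_on_def by meson
      then have "Ck_on m (S \<inter> U) f"
        using Ck_on_cong[of "S \<inter> U" g f m] Ck_on_subset[of m U g "S \<inter> U"] assms by auto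
      then show "\<exists>U. open U \<and> x \<in> U \<and> Ck_on m U f"
        using \<open>open U\<close> \<open>x \<in> U\<close> \<open>x \<in> S\<close> assms by (intro exI[of _ "S \<inter> U"]) auto
    qed
  qed
next
  assume "\<forall>m. Ck_on m S f"
  then show "smooth_on S f" using assms unfolding smooth_on_def by blast
qed

lemma Ck_on_const [simp]: "open U \<Longrightarrow> Ck_on m U (\<lambda>x. c)"
proof (induction m arbitrary: c)
  case (Suc m)
  show ?case by (rule Ck_on_SucI[OF \<open>open U\<close> has_derivative_const]) (use Suc in simp)
qed simp

lemma Ck_on_linear:
  assumes "bounded_linear f" "open U"
  shows "Ck_on m U f"
proof (cases m)
  case 0
  then show ?thesis using assms by (simp add: linear_continuous_on)
next
  case (Suc n)
  show ?thesis unfolding Suc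
    by (rule Ck_on_SucI[OF \<open>open U\<close> bounded_linear_imp_has_derivative[OF assms(1)]])
      (use assms in simp)
qed

lemma Ck_on_add:
  assumes "open U" "Ck_on m U f" "Ck_on m U g"
  shows "Ck_on m U (\<lambda>x. f x + g x)"
  using assms(2,3)
proof (induction m arbitrary: f g)
  case 0
  then show ?case by (auto intro: continuous_intros)
next
  case (Suc m)
  show ?case
    by (rule Ck_on_SucI[OF \<open>open U\<close> has_derivative_add[OF Ck_on_has_derivative Ck_on_has_derivative]])
      (use Suc in \<open>simp_all del: Ck_on.simps add: Ck_on_derivative\<close>)
qed

lemma Ck_on_bounded_linear:
  assumes "bounded_linear T" "open U" "Ck_on m U f"
  shows "Ck_on m U (\<lambda>x. T (f x))"
  using assms(3)
proof (induction m arbitrary: f)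
  case 0
  then show ?case using assms(1) by (auto intro: bounded_linear.continuous_on)
next
  case (Suc m)
  show ?case
    by (rule Ck_on_SucI[OF \<open>open U\<close> bounded_linear.has_derivative[OF assms(1) Ck_on_has_derivative]])
      (use Suc in \<open>simp_all del: Ck_on.simps add: Ck_on_derivative\<close>)
qed

lemma Ck_on_minus: "open U \<Longrightarrow> Ck_on m U f \<Longrightarrow> Ck_on m U (\<lambda>x. - f x)"
  by (rule Ck_on_bounded_linear[OF bounded_linear_minus[OF bounded_linear_ident]])

lemma Ck_on_diff:
  assumes "open U" "Ck_on m U f" "Ck_on m U g"
  shows "Ck_on m U (\<lambda>x. f x - g x)"
  using Ck_on_add[OF assms(1,2) Ck_on_minus[OF assms(1,3)]] by simp

lemma Ck_on_sum:
  assumes "open U" "\<And>i. i \<in> I \<Longrightarrow> Ck_on m U (f i)"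
  shows "Ck_on m U (\<lambda>x. \<Sum>i\<in>I. f i x)"
  using assms(2)
proof (induction I rule: infinite_finite_induct)
  case (insert i I)
  then show ?case by (simp add: Ck_on_add assms(1))
qed (use assms(1) in simp_all)

lemma Ck_on_bilinear:
  fixes prod :: "'a::euclidean_space \<Rightarrow> 'b::euclidean_space \<Rightarrow> 'c::euclidean_space"
  assumes "bounded_bilinear prod" "open U" "Ck_on m U f" "Ck_on m U g"
  shows "Ck_on m U (\<lambda>x. prod (f x) (g x))"
  using assms(3,4)
proof (induction m arbitrary: f g)
  case 0
  then show ?case using assms(1) by (auto intro: bounded_bilinear.continuous_on)
next
  case (Suc m)
  show ?case
  proof (rule Ck_on_SucI[OF \<open>open U\<close> bounded_bilinear.FDERIV[OF assms(1)]])
    fix x assume "x \<in> U"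
    then show "(f has_derivative frechet_derivative f (at x)) (at x)"
      "(g has_derivative frechet_derivative g (at x)) (at x)"
      using Suc.prems Ck_on_has_derivative by blast+
  next
    fix v
    show "Ck_on m U (\<lambda>x. prod (f x) (frechet_derivative g (at x) v)
        + prod (frechet_derivative f (at x) v) (g x))"
      by (intro Ck_on_add[OF \<open>open U\<close>] Suc.IH Ck_on_derivative Suc.prems
          Ck_on_SucD[OF Suc.prems(1)] Ck_on_SucD[OF Suc.prems(2)])
  qed
qed

lemma Ck_on_inner:
  "open U \<Longrightarrow> Ck_on m U f \<Longrightarrow> Ck_on m U g \<Longrightarrow> Ck_on m U (\<lambda>x. f x \<bullet> g x)"
  by (rule Ck_on_bilinear[OF bounded_bilinear_inner])

lemma Ck_on_scaleR:
  "open U \<Longrightarrow> Ck_on m U f \<Longrightarrow> Ck_on m U g \<Longrightarrow> Ck_on m U (\<lambda>x. f x *\<^sub>R g x)"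
  by (rule Ck_on_bilinear[OF bounded_bilinear_scaleR])

lemma Ck_on_Pair:
  assumes "open U" "Ck_on m U f" "Ck_on m U g"
  shows "Ck_on m U (\<lambda>x. (f x, g x))"
proof -
  have "Ck_on m U (\<lambda>x. (f x, 0) + (0, g x))"
    using assms
    by (intro Ck_on_add
        Ck_on_bounded_linear[OF bounded_linear_Pair[OF bounded_linear_ident bounded_linear_zero]]
        Ck_on_bounded_linear[OF bounded_linear_Pair[OF bounded_linear_zero bounded_linear_ident]])
  then show ?thesis by simp
qed

text \<open>The derivative of the composite at \<open>x\<close> is \<open>Df\<close> at \<open>g x\<close> applied to a vector that itself depends on
\<open>x\<close>. Expanding this vector in the standard basis leaves only derivatives of \<open>f\<close> in fixed directions,
to which the induction hypothesis applies.\<close>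

lemma Ck_on_compose:
  fixes f :: "'b::euclidean_space \<Rightarrow> 'c::euclidean_space" and g :: "'a::euclidean_space \<Rightarrow> 'b"
  assumes "open U" "g ` U \<subseteq> V" "Ck_on m V f" "Ck_on m U g"
  shows "Ck_on m U (\<lambda>x. f (g x))"
  using assms(3,4)
proof (induction m arbitrary: f)
  case 0
  then show ?case using assms(2) by (auto intro: continuous_on_compose2)
next
  case (Suc m)
  have split: "frechet_derivative f (at (g x)) (frechet_derivative g (at x) v) =
      (\<Sum>b\<in>Basis. (frechet_derivative g (at x) v \<bullet> b) *\<^sub>R frechet_derivative f (at (g x)) b)"
    if "x \<in> U" for x v
  proof -
    have "linear (frechet_derivative f (at (g x)))"
      using Suc.prems that assms(2) by (auto intro!: linear_frechet_derivative)
    then show ?thesis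
      by (subst euclidean_representation[of "frechet_derivative g (at x) v", symmetric])
        (simp only: linear_sum linear_scale)
  qed
  show ?case
  proof (rule Ck_on_SucI[OF \<open>open U\<close>])
    fix x assume "x \<in> U"
    then have "g x \<in> V" using assms(2) by blast
    then show "((\<lambda>x. f (g x)) has_derivative
        (\<lambda>v. frechet_derivative f (at (g x)) (frechet_derivative g (at x) v))) (at x)"
      by (rule has_derivative_compose[OF Ck_on_has_derivative[OF Suc.prems(2) \<open>x \<in> U\<close>]
            Ck_on_has_derivative[OF Suc.prems(1)]])
  next
    fix v
    have "Ck_on m U (\<lambda>x. \<Sum>b\<in>Basis. (frechet_derivative g (at x) v \<bullet> b) *\<^sub>R
        frechet_derivative f (at (g x)) b)"
      by (intro Ck_on_sum Ck_on_scaleR Ck_on_inner Ck_on_const Ck_on_derivative[OF Suc.prems(2)]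
          Suc.IH[OF Ck_on_derivative[OF Suc.prems(1)] Ck_on_SucD[OF Suc.prems(2)]] \<open>open U\<close>)
    then show "Ck_on m U (\<lambda>x. frechet_derivative f (at (g x)) (frechet_derivative g (at x) v))"
      by (rule iffD1[OF Ck_on_cong[OF \<open>open U\<close>], rotated]) (simp add: split)
  qed
qed

text \<open>The derivatives of \<open>inverse\<close>, and of \<open>norm\<close> below, are built by products from linear maps, the
function itself and inverses, so each order of differentiability gives the next.\<close>

lemma Ck_on_inverse: "Ck_on m (- {0::real}) inverse"
proof (induction m)
  case 0
  show ?case by (auto intro!: continuous_intros)
next
  case (Suc m)
  have op: "open (- {0::real})" by (simp add: open_Compl)
  show ?case
  proof (rule Ck_on_SucI[OF op])
    fix x :: real assume "x \<in> - {0}"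
    then show "(inverse has_derivative (\<lambda>v. - ((inverse x *\<^sub>R inverse x) *\<^sub>R v))) (at x)"
      by (auto intro!: derivative_eq_intros)
  qed (intro Ck_on_minus Ck_on_scaleR op Suc Ck_on_const)
qed

lemma Ck_on_norm: "Ck_on m (- {0}) (norm :: 'a::euclidean_space \<Rightarrow> real)"
proof (induction m)
  case 0
  show ?case by (auto intro!: continuous_intros)
next
  case (Suc m)
  have op: "open (- {0::'a})" by (simp add: open_Compl)
  show ?case
  proof (rule Ck_on_SucI[OF op])
    fix x :: 'a assume "x \<in> - {0}"
    then show "(norm has_derivative (\<lambda>v. (v \<bullet> x) *\<^sub>R inverse (norm x))) (at x)"
      using has_derivative_norm[of x] by (simp add: sgn_div_norm inner_commute divide_inverse mult.commute)
  next
    fix v :: 'a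
    show "Ck_on m (- {0}) (\<lambda>x::'a. (v \<bullet> x) *\<^sub>R inverse (norm x))"
      by (intro Ck_on_scaleR Ck_on_inner op Ck_on_const Ck_on_linear bounded_linear_ident
          Ck_on_compose[OF op _ Ck_on_inverse Suc]) auto
  qed
qed

lemma Ck_on_conormal: "Ck_on m {(p, q). p \<noteq> q} (\<lambda>(p, q). conormal p q)"
proof -
  let ?D = "{z::'a::euclidean_space \<times> 'a. fst z \<noteq> snd z}"
  have op: "open ?D" by (intro open_Collect_neq continuous_intros)
  have d: "Ck_on m ?D (\<lambda>z. fst z - snd z)"
    by (intro Ck_on_diff op Ck_on_linear bounded_linear_fst bounded_linear_snd)
  have "Ck_on m ?D (\<lambda>z. inverse (norm (fst z - snd z)) *\<^sub>R (fst z - snd z))"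
    by (intro Ck_on_scaleR op d Ck_on_compose[OF op _ Ck_on_inverse]
        Ck_on_compose[OF op _ Ck_on_norm d]) auto
  then show ?thesis by (simp add: conormal_def case_prod_unfold)
qed

section \<open>Orthogonal projection onto a moving subspace\<close>

text \<open>Uniqueness of the orthogonal projection, so that its defining description can be evaluated.\<close>

lemma orthogonal_projection_eqI:
  assumes "subspace W" "w \<in> W" "\<And>y. y \<in> W \<Longrightarrow> (v - w) \<bullet> y = 0"
  shows "orthogonal_projection W v = w"
  unfolding orthogonal_projection_def
proof (rule the_equality)
  show "w \<in> W \<and> (\<forall>y\<in>W. orthogonal (v - w) y)"
    using assms by (simp add: orthogonal_def)
  fix z assume z: "z \<in> W \<and> (\<forall>y\<in>W. orthogonal (v - z) y)"
  then have "z - w \<in> W" using assms by (auto intro: subspace_diff)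
  then have "(v - w) \<bullet> (z - w) = 0" "(v - z) \<bullet> (z - w) = 0"
    using assms z by (auto simp: orthogonal_def)
  then have "(z - w) \<bullet> (z - w) = 0" by (simp add: inner_diff_left)
  then show "z = w" by simp
qed

lemma orthogonal_projection:
  assumes "subspace W"
  shows orthogonal_projection_mem: "orthogonal_projection W v \<in> W"
    and orthogonal_projection_orthogonal: "y \<in> W \<Longrightarrow> (v - orthogonal_projection W v) \<bullet> y = 0"
proof -
  obtain w z where "w \<in> span W" and z: "\<And>y. y \<in> span W \<Longrightarrow> orthogonal z y" and v: "v = w + z"
    using orthogonal_subspace_decomp_exists[of W v] by blast
  then have w: "w \<in> W" and z': "\<And>y. y \<in> W \<Longrightarrow> (v - w) \<bullet> y = 0"
    unfolding span_eq_iff[THEN iffD2, OF assms] by (auto simp: orthogonal_def)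
  have "orthogonal_projection W v = w"
    by (rule orthogonal_projection_eqI[OF assms w z'])
  with w z' show "orthogonal_projection W v \<in> W"
    "y \<in> W \<Longrightarrow> (v - orthogonal_projection W v) \<bullet> y = 0" by auto
qed

text \<open>A subspace is cut out by scalar equations. This turns the question whether a curve or its velocity lies in
\<open>L\<close> into one about real-valued functions of time.\<close>

lemma mem_subspace_iff_orthogonal:
  fixes L :: "'a::euclidean_space set"
  assumes "subspace L"
  shows "v \<in> L \<longleftrightarrow> (\<forall>y. (\<forall>l\<in>L. y \<bullet> l = 0) \<longrightarrow> y \<bullet> v = 0)"
proof
  assume v: "\<forall>y. (\<forall>l\<in>L. y \<bullet> l = 0) \<longrightarrow> y \<bullet> v = 0"
  let ?p = "orthogonal_projection L v"
  note p = orthogonal_projection[OF assms]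
  have "(v - ?p) \<bullet> v = 0" "(v - ?p) \<bullet> ?p = 0"
    using v p by blast+
  then have "(v - ?p) \<bullet> (v - ?p) = 0" by (simp add: inner_diff_right)
  then have "v = ?p" by simp
  then show "v \<in> L" using p(1)[of v] by simp
qed blast

text \<open>The Gram-Schmidt step: \<open>e\<close> is the part of the new vector orthogonal to the old span, and the projection
gains exactly the component along \<open>e\<close>.\<close>

lemma orthogonal_projection_span_insert:
  fixes a :: "'a::euclidean_space" and S :: "'a set"
  defines "e \<equiv> a - orthogonal_projection (span S) a"
  assumes "a \<notin> span S"
  shows "e \<bullet> e \<noteq> 0"
    and "orthogonal_projection (span (insert a S)) v =
      orthogonal_projection (span S) v + ((v \<bullet> e) * inverse (e \<bullet> e)) *\<^sub>R e"
proof -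
  note p = orthogonal_projection[OF subspace_span[of S]]
  have "e \<noteq> 0" using assms(2) p(1)[of a] unfolding e_def by auto
  then show e0: "e \<bullet> e \<noteq> 0" by simp
  have sub: "span S \<subseteq> span (insert a S)" by (rule span_mono) blast
  have eS: "e \<bullet> y = 0" if "y \<in> span S" for y
    unfolding e_def using p(2) that by blast
  let ?c = "(v \<bullet> e) * inverse (e \<bullet> e)"
  let ?r = "v - orthogonal_projection (span S) v"
  show "orthogonal_projection (span (insert a S)) v = orthogonal_projection (span S) v + ?c *\<^sub>R e"
  proof (rule orthogonal_projection_eqI[OF subspace_span])
    have "e \<in> span (insert a S)"
      unfolding e_def using p(1)[of a] sub by (meson span_base insertI1 span_diff subsetD)
    then show "orthogonal_projection (span S) v + ?c *\<^sub>R e \<in> span (insert a S)"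
      using p(1)[of v] sub by (meson span_add span_scale subsetD)
  next
    fix y assume "y \<in> span (insert a S)"
    then obtain k where k: "y - k *\<^sub>R a \<in> span S" by (auto simp: span_breakdown_eq)
    \<comment> \<open>Vectors of the larger span are multiples of e plus vectors of the old span.\<close>
    define w where "w = (y - k *\<^sub>R a) + k *\<^sub>R orthogonal_projection (span S) a"
    have w: "w \<in> span S" unfolding w_def using k p(1) by (intro span_add span_scale)
    have y: "y = k *\<^sub>R e + w" unfolding w_def e_def by (simp add: algebra_simps)
    have "orthogonal_projection (span S) v \<bullet> e = 0"
      using eS[OF p(1)] by (simp add: inner_commute)
    then have "(?r - ?c *\<^sub>R e) \<bullet> e = 0"
      using e0 by (simp add: inner_diff_left)
    moreover have "(?r - ?c *\<^sub>R e) \<bullet> w = 0"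
      using p(2)[OF w, of v] eS[OF w] by (simp add: inner_diff_left)
    ultimately have "(?r - ?c *\<^sub>R e) \<bullet> y = 0"
      unfolding y by (simp only: inner_add_right inner_scaleR_right mult_zero_right add_0)
    then show "(v - (orthogonal_projection (span S) v + ?c *\<^sub>R e)) \<bullet> y = 0"
      by (simp add: diff_diff_eq)
  qed
qed

text \<open>A moving subspace with a \<open>C\<^sup>m\<close> frame has a \<open>C\<^sup>m\<close> orthogonal projection. The frame is the image of a
fixed basis under injective linear maps, so its vectors stay independent and the divisor in each
Gram-Schmidt step never vanishes. Smoothness is joint in the base point and the projected vector,
because the conormal to be projected moves along with the base point.\<close>

lemma Ck_on_orthogonal_projection:
  fixes A :: "'a::euclidean_space \<Rightarrow> 'b::euclidean_space \<Rightarrow> 'c::euclidean_space"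
  assumes "open U" and A: "\<And>x. x \<in> U \<Longrightarrow> linear (A x)" "\<And>x. x \<in> U \<Longrightarrow> inj (A x)"
    and "finite B" "independent B" "\<And>b. b \<in> B \<Longrightarrow> Ck_on m U (\<lambda>x. A x b)"
  shows "Ck_on m (U \<times> UNIV) (\<lambda>(x, v). orthogonal_projection (A x ` span B) v)"
proof -
  let ?E = "U \<times> (UNIV :: 'c set)"
  have op: "open ?E" using \<open>open U\<close> by (simp add: open_Times)
  have "Ck_on m ?E (\<lambda>z. orthogonal_projection (span (A (fst z) ` B)) (snd z))"
    using assms(4-6)
  proof (induction B rule: finite_induct)
    case empty
    have "orthogonal_projection {0} v = 0" for v :: 'c
      by (rule orthogonal_projection_eqI) auto
    then show ?case using op by simp
  next
    case (insert b B)
    let ?w = "\<lambda>x. A x b"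
    define e where "e x = ?w x - orthogonal_projection (span (A x ` B)) (?w x)" for x
    have w: "Ck_on m U ?w" by (rule insert.prems) simp
    have pr: "Ck_on m ?E (\<lambda>z. orthogonal_projection (span (A (fst z) ` B)) (snd z))"
      using insert.prems by (intro insert.IH) (auto simp: independent_insert insert.hyps)
    have "Ck_on m U (\<lambda>x. orthogonal_projection (span (A (fst (x, ?w x)) ` B)) (snd (x, ?w x)))"
      by (rule Ck_on_compose[OF \<open>open U\<close> _ pr
            Ck_on_Pair[OF \<open>open U\<close> Ck_on_linear[OF bounded_linear_ident \<open>open U\<close>] w]]) auto
    then have "Ck_on m U e"
      unfolding e_def using \<open>open U\<close> w by (intro Ck_on_diff) auto
    then have e: "Ck_on m ?E (\<lambda>z. e (fst z))"
      by (rule Ck_on_compose[OF op _ _ Ck_on_linear[OF bounded_linear_fst op], rotated]) auto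
    have notin: "A x b \<notin> span (A x ` B)" if "x \<in> U" for x
    proof -
      have "b \<notin> span B"
        using insert.prems(1) insert.hyps by (simp add: independent_insert)
      then show ?thesis
        using A[OF that] by (auto simp: linear_span_image dest: injD)
    qed
    note step = orthogonal_projection_span_insert[OF notin, folded e_def]
    have "Ck_on m ?E (\<lambda>z. orthogonal_projection (span (A (fst z) ` B)) (snd z) +
        ((snd z \<bullet> e (fst z)) *\<^sub>R inverse (e (fst z) \<bullet> e (fst z))) *\<^sub>R e (fst z))"
      by (intro Ck_on_add Ck_on_scaleR Ck_on_inner pr e op Ck_on_linear[OF bounded_linear_snd]
          Ck_on_compose[OF op _ Ck_on_inverse]) (use step(1) in auto)
    then show ?case
      by (rule iffD1[OF Ck_on_cong[OF op], rotated]) (auto simp: step(2))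
  qed
  then show ?thesis
    by (rule iffD1[OF Ck_on_cong[OF op], rotated]) (auto simp: linear_span_image[OF A(1)])
qed

section \<open>Slice charts and tangent spaces\<close>

locale slice_chart =
  fixes \<Sigma> U V :: "'a::euclidean_space set" and \<phi> \<psi> :: "'a \<Rightarrow> 'a" and L :: "'a set"
  assumes open_U: "open U" and open_V: "open V"
    and diffeo: "diffeomorphism U V \<phi> \<psi>"
    and subspace_L: "subspace L"
    and slice: "\<phi> ` (U \<inter> \<Sigma>) = V \<inter> L"
begin

abbreviation "D\<phi> x \<equiv> frechet_derivative \<phi> (at x)"
abbreviation "D\<psi> y \<equiv> frechet_derivative \<psi> (at y)"

lemma chart_maps:
  shows "x \<in> U \<Longrightarrow> \<phi> x \<in> V" "y \<in> V \<Longrightarrow> \<psi> y \<in> U"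
    and "x \<in> U \<Longrightarrow> \<psi> (\<phi> x) = x" "y \<in> V \<Longrightarrow> \<phi> (\<psi> y) = y"
  using diffeo unfolding diffeomorphism_def homeomorphism_def by auto

lemma Ck_\<phi>: "Ck_on m U \<phi>" and Ck_\<psi>: "Ck_on m V \<psi>"
  using diffeo open_U open_V unfolding diffeomorphism_def by (auto simp: smooth_on_open_iff)

lemma has_derivative_\<phi>: "x \<in> U \<Longrightarrow> (\<phi> has_derivative D\<phi> x) (at x)"
  and has_derivative_\<psi>: "y \<in> V \<Longrightarrow> (\<psi> has_derivative D\<psi> y) (at y)"
  by (rule Ck_on_has_derivative[OF Ck_\<phi>], assumption, rule Ck_on_has_derivative[OF Ck_\<psi>])

lemma derivatives_inverse:
  assumes "x \<in> U"
  shows "D\<psi> (\<phi> x) (D\<phi> x v) = v" "D\<phi> x (D\<psi> (\<phi> x) v) = v"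
proof -
  have "((\<lambda>x. \<psi> (\<phi> x)) has_derivative (\<lambda>v. D\<psi> (\<phi> x) (D\<phi> x v))) (at x)"
    by (rule has_derivative_compose[OF has_derivative_\<phi> has_derivative_\<psi>]) (use assms chart_maps in auto)
  then have "((\<lambda>x. x) has_derivative (\<lambda>v. D\<psi> (\<phi> x) (D\<phi> x v))) (at x)"
    by (rule has_derivative_transform_within_open[OF _ open_U assms]) (simp add: chart_maps)
  from has_derivative_unique[OF this has_derivative_ident]
  show "D\<psi> (\<phi> x) (D\<phi> x v) = v" by metis
  have y: "\<phi> x \<in> V" "\<psi> (\<phi> x) = x" using assms chart_maps by auto
  have "((\<lambda>y. \<phi> (\<psi> y)) has_derivative (\<lambda>v. D\<phi> x (D\<psi> (\<phi> x) v))) (at (\<phi> x))"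
    by (rule has_derivative_compose[OF has_derivative_\<psi>[OF y(1)]])
      (use has_derivative_\<phi>[OF assms] y in simp)
  then have "((\<lambda>y. y) has_derivative (\<lambda>v. D\<phi> x (D\<psi> (\<phi> x) v))) (at (\<phi> x))"
    by (rule has_derivative_transform_within_open[OF _ open_V y(1)]) (simp add: chart_maps)
  from has_derivative_unique[OF this has_derivative_ident]
  show "D\<phi> x (D\<psi> (\<phi> x) v) = v" by metis
qed

lemma mem_iff: 
  assumes x: "x \<in> U"
  shows "x \<in> \<Sigma> \<longleftrightarrow> \<phi> x \<in> L"
proof
  show "\<phi> x \<in> L" if "x \<in> \<Sigma>" using slice x that by blast
  assume "\<phi> x \<in> L"
  then have "\<phi> x \<in> \<phi> ` (U \<inter> \<Sigma>)" using slice x chart_maps(1) by blast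
  then obtain x' where "x' \<in> U" "x' \<in> \<Sigma>" "\<phi> x = \<phi> x'" by blast
  then show "x \<in> \<Sigma>" using x chart_maps(3) by metis
qed

lemma vector_derivative_\<phi>:
  assumes "(\<gamma> has_vector_derivative v) (at t within J)" "\<gamma> t \<in> U"
  shows "((\<lambda>t. y \<bullet> \<phi> (\<gamma> t)) has_vector_derivative y \<bullet> D\<phi> (\<gamma> t) v) (at t within J)"
proof -
  have "((\<lambda>t. \<phi> (\<gamma> t)) has_derivative (\<lambda>h. D\<phi> (\<gamma> t) (h *\<^sub>R v))) (at t within J)"
    using assms by (intro has_derivative_compose[OF _ has_derivative_\<phi>])
      (auto simp: has_vector_derivative_def)
  then have "((\<lambda>t. y \<bullet> \<phi> (\<gamma> t)) has_derivative (\<lambda>h. y \<bullet> D\<phi> (\<gamma> t) (h *\<^sub>R v))) (at t within J)"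
    by (rule has_derivative_inner_right)
  moreover have "linear (D\<phi> (\<gamma> t))"
    using has_derivative_\<phi>[OF assms(2)] by (rule has_derivative_linear)
  ultimately show ?thesis
    by (simp add: has_vector_derivative_def linear_scale)
qed

text \<open>The chart straightens \<open>\<Sigma>\<close> to \<open>L\<close>: a line in \<open>L\<close> pulls back to a curve in \<open>\<Sigma>\<close>, which realizes every
vector on the right as a velocity; conversely the image of a curve in \<open>\<Sigma>\<close> runs in \<open>L\<close>, and so does its
velocity.\<close>

lemma tangent_space_eq:
  assumes "x \<in> U" "x \<in> \<Sigma>"
  shows "tangent_space \<Sigma> x = D\<psi> (\<phi> x) ` L"
proof
  have y: "\<phi> x \<in> V" "\<psi> (\<phi> x) = x" "\<phi> x \<in> L" using assms chart_maps mem_iff by auto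
  show "D\<psi> (\<phi> x) ` L \<subseteq> tangent_space \<Sigma> x"
  proof
    fix v assume "v \<in> D\<psi> (\<phi> x) ` L"
    then obtain l where l: "l \<in> L" "v = D\<psi> (\<phi> x) l" by auto
    let ?\<gamma> = "\<lambda>t::real. \<phi> x + t *\<^sub>R l"
    have "open (?\<gamma> -` V)" by (intro open_vimage open_V continuous_intros)
    moreover have zero: "0 \<in> ?\<gamma> -` V" using y(1) by simp
    ultimately obtain \<delta> where \<delta>: "\<delta> > 0" "\<And>t. dist t 0 < \<delta> \<Longrightarrow> ?\<gamma> t \<in> V"
      unfolding open_dist by (metis vimageD)
    let ?J = "{-\<delta><..<\<delta>}"
    have V: "?\<gamma> t \<in> V" if "t \<in> ?J" for t using \<delta>(2)[of t] that by (auto simp: dist_real_def)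
    have Ck: "Ck_on m ?J (\<lambda>t. \<psi> (?\<gamma> t))" for m
    proof (rule Ck_on_compose[OF _ _ Ck_\<psi>])
      show "Ck_on m ?J ?\<gamma>"
        by (intro Ck_on_add Ck_on_const Ck_on_linear[OF bounded_linear_scaleR_left]
            open_greaterThanLessThan)
    qed (use V in auto)
    have "\<psi> (?\<gamma> t) \<in> \<Sigma>" if "t \<in> ?J" for t
      using V[OF that] y l subspace_L
      by (auto simp: mem_iff chart_maps intro: subspace_add subspace_scale)
    moreover have "((\<lambda>t. \<psi> (?\<gamma> t)) has_vector_derivative v) (at 0)"
    proof -
      have "(?\<gamma> has_derivative (\<lambda>h. h *\<^sub>R l)) (at 0)"
        by (auto intro!: derivative_eq_intros)
      then have "((\<lambda>t. \<psi> (?\<gamma> t)) has_derivative (\<lambda>h. D\<psi> (\<phi> x) (h *\<^sub>R l))) (at 0)"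
        by (rule has_derivative_compose) (simp add: has_derivative_\<psi> y)
      then show ?thesis
        using has_derivative_linear[OF has_derivative_\<psi>[OF y(1)]]
        by (simp add: has_vector_derivative_def linear_scale l)
    qed
    ultimately show "v \<in> tangent_space \<Sigma> x"
      unfolding tangent_space_def using Ck \<delta>(1) y
      by (intro CollectI exI[of _ \<delta>] conjI exI[of _ "\<lambda>t. \<psi> (?\<gamma> t)"]) (auto simp: smooth_on_open_iff)
  qed
  show "tangent_space \<Sigma> x \<subseteq> D\<psi> (\<phi> x) ` L"
  proof
    fix v assume "v \<in> tangent_space \<Sigma> x"
    then obtain \<delta> \<gamma> where \<delta>: "\<delta> > 0" and sm: "smooth_on {-\<delta><..<\<delta>} \<gamma>" and im: "\<gamma> ` {-\<delta><..<\<delta>} \<subseteq> \<Sigma>"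
      and \<gamma>: "\<gamma> (0::real) = x" "(\<gamma> has_vector_derivative v) (at 0)"
      unfolding tangent_space_def by blast
    \<comment> \<open>Only near time 0 is the curve known to stay in the chart domain.\<close>
    have "continuous_on {-\<delta><..<\<delta>} \<gamma>"
      using sm by (metis Ck_on.simps(1) open_greaterThanLessThan smooth_on_open_iff)
    then have op: "open ({-\<delta><..<\<delta>} \<inter> \<gamma> -` U)"
      using open_U by (simp add: continuous_on_open_vimage Int_commute)
    have "D\<phi> x v \<in> L"
      unfolding mem_subspace_iff_orthogonal[OF subspace_L]
    proof (intro allI impI)
      fix z assume z: "\<forall>l\<in>L. z \<bullet> l = 0"
      have der: "((\<lambda>t. z \<bullet> \<phi> (\<gamma> t)) has_vector_derivative z \<bullet> D\<phi> x v) (at 0)"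
        using vector_derivative_\<phi>[OF \<gamma>(2)] \<gamma>(1) assms by simp
      have const: "z \<bullet> \<phi> (\<gamma> t) = 0" if "t \<in> {-\<delta><..<\<delta>} \<inter> \<gamma> -` U" for t
        using that im z mem_iff[of "\<gamma> t"] by blast
      have "((\<lambda>t. 0) has_vector_derivative z \<bullet> D\<phi> x v) (at 0)"
        by (rule has_vector_derivative_transform_within_open[OF der op _ const])
          (use \<delta> \<gamma> assms in auto)
      then show "z \<bullet> D\<phi> x v = 0"
        using vector_derivative_unique_at[OF _ has_vector_derivative_const] by blast
    qed
    then show "v \<in> D\<psi> (\<phi> x) ` L"
      using derivatives_inverse(1)[OF assms(1), of v] by (metis imageI)
  qed
qed

text \<open>The velocity condition is imposed at all points of the curve, also at those not yet known to lie on
\<open>\<Sigma>\<close>. In the chart it says that the velocity is in \<open>L\<close>, so that every linear functional vanishing on \<open>L\<close>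
is constant along the image of the curve, with value 0 at the time when the curve is on \<open>\<Sigma>\<close>.\<close>

lemma curve_stays_in:
  assumes J: "convex J" "t0 \<in> J" "\<gamma> t0 \<in> \<Sigma>" and U: "\<And>t. t \<in> J \<Longrightarrow> \<gamma> t \<in> U"
    and \<gamma>: "\<And>t. t \<in> J \<Longrightarrow> (\<gamma> has_vector_derivative \<gamma>' t) (at t within J)"
    and tangent: "\<And>t. t \<in> J \<Longrightarrow> \<gamma>' t \<in> D\<psi> (\<phi> (\<gamma> t)) ` L"
    and "t \<in> J"
  shows "\<gamma> t \<in> \<Sigma>"
proof -
  have "\<phi> (\<gamma> t) \<in> L"
    unfolding mem_subspace_iff_orthogonal[OF subspace_L]
  proof (intro allI impI)
    fix z assume z: "\<forall>l\<in>L. z \<bullet> l = 0"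
    have "((\<lambda>t. z \<bullet> \<phi> (\<gamma> t)) has_vector_derivative 0) (at s within J)" if s: "s \<in> J" for s
    proof -
      obtain l where "l \<in> L" "\<gamma>' s = D\<psi> (\<phi> (\<gamma> s)) l" using tangent[OF s] by auto
      then have "z \<bullet> D\<phi> (\<gamma> s) (\<gamma>' s) = 0"
        using z derivatives_inverse(2)[OF U[OF s]] by simp
      then show ?thesis using vector_derivative_\<phi>[OF \<gamma>[OF s] U[OF s], of z] by simp
    qed
    then obtain c where "\<And>s. s \<in> J \<Longrightarrow> z \<bullet> \<phi> (\<gamma> s) = c"
      using has_vector_derivative_zero_constant[OF J(1)] by blast
    moreover have "z \<bullet> \<phi> (\<gamma> t0) = 0"
      using J z U mem_iff by blast
    ultimately show "z \<bullet> \<phi> (\<gamma> t) = 0" using J \<open>t \<in> J\<close> by metis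
  qed
  then show ?thesis using U[OF \<open>t \<in> J\<close>] mem_iff by blast
qed

text \<open>The extension of the tangential projection to all points of the chart domain.\<close>

definition extended_projection :: "'a \<Rightarrow> 'a \<Rightarrow> 'a" where
  "extended_projection x v = orthogonal_projection (D\<psi> (\<phi> x) ` L) v"

lemma extended_projection_eq_tangential_part: "x \<in> U \<Longrightarrow> x \<in> \<Sigma> \<Longrightarrow> extended_projection x v = tangential_part \<Sigma> x v"
  by (simp add: extended_projection_def tangential_part_def tangent_space_eq)

lemma linear_D\<psi>: "x \<in> U \<Longrightarrow> linear (D\<psi> (\<phi> x))"
  using has_derivative_linear[OF has_derivative_\<psi>] chart_maps by blast

lemma extended_projection_mem: "x \<in> U \<Longrightarrow> extended_projection x v \<in> D\<psi> (\<phi> x) ` L"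
  unfolding extended_projection_def by (intro orthogonal_projection_mem linear_subspace_image linear_D\<psi> subspace_L)

lemma Ck_extended_projection: "Ck_on m (U \<times> UNIV) (\<lambda>(x, v). extended_projection x v)"
proof -
  obtain B where B: "finite B" "independent B" "span B = L"
    by (metis basis_exists subspace_L independent_bound span_eq_iff span_mono subset_antisym)
  have "inj (D\<psi> (\<phi> x))" if "x \<in> U" for x
    using derivatives_inverse(2)[OF that] by (metis injI)
  moreover have "Ck_on m U (\<lambda>x. D\<psi> (\<phi> x) b)" for b
    by (rule Ck_on_compose[OF open_U _ Ck_on_derivative[OF Ck_\<psi>] Ck_\<phi>]) (use chart_maps in auto)
  ultimately have "Ck_on m (U \<times> UNIV)
      (\<lambda>(x, v). orthogonal_projection (D\<psi> (\<phi> x) ` span B) v)"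
    by (intro Ck_on_orthogonal_projection open_U linear_D\<psi> B)
  then show ?thesis by (simp only: extended_projection_def B(3))
qed

end

section \<open>Ordinary differential equations\<close>

text \<open>On a compact ball the derivatives in the basis directions are bounded, hence so is the operator norm of
the derivative.\<close>

lemma Ck_on_locally_lipschitz:
  fixes F :: "'a::euclidean_space \<Rightarrow> 'b::euclidean_space"
  assumes "open S" "x \<in> S" "Ck_on (Suc 0) S F"
  obtains r K where "r > 0" "cball x r \<subseteq> S" "K-lipschitz_on (cball x r) F"
proof -
  obtain r where r: "r > 0" "cball x r \<subseteq> S"
    using assms open_contains_cball by blast
  have "\<exists>M. \<forall>y\<in>cball x r. norm (frechet_derivative F (at y) b) \<le> M" for b
  proof -
    have "continuous_on (cball x r) (\<lambda>y. frechet_derivative F (at y) b)"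
      using Ck_on_derivative[OF assms(3)] r(2) by (auto intro: continuous_on_subset)
    then have "bounded ((\<lambda>y. frechet_derivative F (at y) b) ` cball x r)"
      by (intro compact_imp_bounded compact_continuous_image compact_cball)
    then show ?thesis by (auto simp: bounded_iff)
  qed
  then obtain M where M: "\<And>b y. y \<in> cball x r \<Longrightarrow> norm (frechet_derivative F (at y) b) \<le> M b"
    by metis
  have M0: "0 \<le> M b" for b using order_trans[OF norm_ge_zero M[of x b]] r by simp
  let ?K = "\<Sum>b\<in>Basis. M b"
  have der: "(F has_derivative frechet_derivative F (at y)) (at y within cball x r)"
    if "y \<in> cball x r" for y
    using Ck_on_has_derivative[OF assms(3)] that r has_derivative_at_withinI by blast
  have on: "onorm (frechet_derivative F (at y)) \<le> ?K" if y: "y \<in> cball x r" for y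
  proof (rule onorm_le)
    fix v
    have lin: "linear (frechet_derivative F (at y))"
      using der[OF y] by (rule has_derivative_linear)
    have "frechet_derivative F (at y) v = (\<Sum>b\<in>Basis. (v \<bullet> b) *\<^sub>R frechet_derivative F (at y) b)"
      by (subst euclidean_representation[of v, symmetric]) (simp only: linear_sum[OF lin] linear_scale[OF lin])
    also have "norm \<dots> \<le> (\<Sum>b\<in>Basis. norm v * M b)"
      by (intro sum_norm_le) (auto intro!: mult_mono M y simp: Basis_le_norm)
    finally show "norm (frechet_derivative F (at y) v) \<le> ?K * norm v"
      by (simp add: sum_distrib_left mult.commute)
  qed
  have "?K-lipschitz_on (cball x r) F"
    unfolding lipschitz_on_def dist_norm
    using differentiable_bound[OF convex_cball der on] M0 by (simp add: sum_nonneg)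
  with r that show ?thesis by blast
qed

text \<open>Precomposing \<open>F\<close> with the nearest-point map of the ball gives a bounded and globally Lipschitz field
\<open>G\<close>, so that the integral operator is defined on all bounded continuous curves and no curve has to be
kept inside the ball while iterating. Times are clamped to \<open>[-h, h]\<close> to have curves on the
whole line. By the bound on \<open>G\<close> the fixed point does stay in the ball for times in \<open>[-h, h]\<close>,
and there \<open>G\<close> and \<open>F\<close> agree. The solution is two-sided in time, which makes it smooth in the ordinary sense at time 0.\<close>

lemma picard_lindelof_existence:
  fixes F :: "'a::euclidean_space \<Rightarrow> 'a"
  assumes "r > 0" and lip: "K-lipschitz_on (cball x0 r) F"
  obtains h x where "h > 0" "x 0 = x0"
    "\<And>t. t \<in> {-h<..<h} \<Longrightarrow> x t \<in> cball x0 r"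
    "\<And>t. t \<in> {-h<..<h} \<Longrightarrow> (x has_vector_derivative F (x t)) (at t)"
proof -
  let ?B = "cball x0 r"
  define G where "G z = F (closest_point ?B z)" for z
  have ne: "?B \<noteq> {}" using \<open>r > 0\<close> by simp
  have K: "K \<ge> 0" using lip by (rule lipschitz_on_nonneg)
  have G_lip: "norm (G y - G z) \<le> K * dist y z" for y z
  proof -
    have "dist (F (closest_point ?B y)) (F (closest_point ?B z))
        \<le> K * dist (closest_point ?B y) (closest_point ?B z)"
      by (intro lipschitz_onD[OF lip] closest_point_in_set closed_cball ne)
    also have "\<dots> \<le> K * dist y z"
      by (intro mult_left_mono closest_point_lipschitz K closed_cball ne convex_cball)
    finally show ?thesis by (simp add: G_def dist_norm)
  qed
  have G_cont: "continuous_on UNIV G"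
    by (rule lipschitz_on_continuous_on[of K]) (use G_lip K in \<open>auto intro!: lipschitz_onI simp: dist_norm\<close>)
  obtain M where M: "M > 0" "\<And>z. norm (G z) \<le> M"
  proof -
    have "compact (F ` ?B)"
      by (intro compact_continuous_image compact_cball lipschitz_on_continuous_on[OF lip])
    then obtain M where "M > 0" "\<And>z. z \<in> F ` ?B \<Longrightarrow> norm z \<le> M"
      using compact_imp_bounded bounded_pos by metis
    moreover have "F (closest_point ?B z) \<in> F ` ?B" for z
      by (intro imageI closest_point_in_set closed_cball ne)
    ultimately show ?thesis using that[of M] unfolding G_def by blast
  qed
  \<comment> \<open>The two bounds make the fixed point stay in the ball and the operator a contraction by 1/2.\<close>
  define h where "h = min (r / (4 * M)) (1 / (8 * (K + 1)))"
  have h: "h > 0" "4 * h * M \<le> r" "4 * h * K \<le> 1 / 2"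
  proof -
    show "h > 0" using \<open>r > 0\<close> M K by (simp add: h_def)
    have "h \<le> r / (4 * M)" by (simp add: h_def)
    then show "4 * h * M \<le> r" using M by (simp add: field_simps)
    have "h \<le> 1 / (8 * (K + 1))" by (simp add: h_def)
    then have "8 * h * (K + 1) \<le> 1" using K by (simp add: field_simps)
    then show "4 * h * K \<le> 1 / 2" using \<open>h > 0\<close> by (simp add: field_simps)
  qed
  define c where "c t = max (-h) (min h t)" for t
  have c: "c t \<in> {-h..h}" for t using h by (auto simp: c_def)
  \<comment> \<open>The integral of u from 0 to t, for t of either sign.\<close>
  define I where "I u t = integral {-h..t} u - integral {-h..0} u" for u :: "real \<Rightarrow> 'a" and t
  have I_bound: "norm (I u t) \<le> 4 * h * b"
    if "continuous_on UNIV u" "\<And>s. norm (u s) \<le> b" "t \<in> {-h..h}" for u t b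
  proof -
    have "norm (integral {-h..s} u) \<le> b * (s - (-h))" if "s \<in> {-h..h}" for s
      using that \<open>continuous_on UNIV u\<close> \<open>\<And>s. norm (u s) \<le> b\<close>
      by (intro integral_bound) (auto intro: continuous_on_subset)
    moreover have "b * (s - (-h)) \<le> b * (2 * h)" if "s \<in> {-h..h}" for s
      using that order_trans[OF norm_ge_zero \<open>norm (u 0) \<le> b\<close>] by (intro mult_left_mono) auto
    ultimately have "norm (integral {-h..s} u) \<le> b * (2 * h)" if "s \<in> {-h..h}" for s
      using that order_trans by blast
    then have "norm (integral {-h..t} u) \<le> b * (2 * h)" "norm (integral {-h..0} u) \<le> b * (2 * h)"
      using that h(1) by auto
    moreover have "4 * h * b = b * (2 * h) + b * (2 * h)" by simp
    ultimately show ?thesis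
      unfolding I_def using norm_triangle_ineq4[of "integral {-h..t} u" "integral {-h..0} u"]
      by linarith
  qed
  have int: "u integrable_on {a..b}" if "continuous_on UNIV u" for u :: "real \<Rightarrow> 'a" and a b
    using that by (meson continuous_on_subset integrable_continuous_interval subset_UNIV)
  have I_cont: "continuous_on UNIV (\<lambda>t. x0 + I u (c t))" if "continuous_on UNIV u" for u
  proof -
    have "continuous_on {-h..h} (\<lambda>t. I u t)"
      unfolding I_def by (intro continuous_intros indefinite_integral_continuous_1 int that)
    moreover have "continuous_on UNIV c" unfolding c_def by (intro continuous_intros)
    ultimately have "continuous_on UNIV (\<lambda>t. I u (c t))"
      using c by (auto intro: continuous_on_compose2)
    then show ?thesis by (intro continuous_intros)
  qed
  have Gx: "continuous_on UNIV (\<lambda>s. G (apply_bcontfun x s))" for x :: "real \<Rightarrow>\<^sub>C 'a"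
    by (intro continuous_on_compose2[OF G_cont]) (auto intro: continuous_on_apply_bcontfun)
  define \<Phi> :: "(real \<Rightarrow>\<^sub>C 'a) \<Rightarrow> (real \<Rightarrow>\<^sub>C 'a)" where
    "\<Phi> x = Bcontfun (\<lambda>t. x0 + I (\<lambda>s. G (apply_bcontfun x s)) (c t))" for x
  have \<Phi>: "apply_bcontfun (\<Phi> x) t = x0 + I (\<lambda>s. G (apply_bcontfun x s)) (c t)" for x t
  proof -
    have "(\<lambda>t. x0 + I (\<lambda>s. G (apply_bcontfun x s)) (c t)) \<in> bcontfun"
    proof (rule bcontfun_normI[OF I_cont[OF Gx]])
      show "norm (x0 + I (\<lambda>s. G (apply_bcontfun x s)) (c t)) \<le> norm x0 + 4 * h * M" for t
        using I_bound[OF Gx M(2) c, of x t] norm_triangle_ineq[of x0 "I (\<lambda>s. G (apply_bcontfun x s)) (c t)"]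
        by linarith
    qed
    then show ?thesis by (simp add: \<Phi>_def Bcontfun_inverse)
  qed
  have "dist (\<Phi> x) (\<Phi> y) \<le> 1 / 2 * dist x y" for x y
  proof (rule dist_bound)
    fix t
    let ?d = "\<lambda>s. G (apply_bcontfun x s) - G (apply_bcontfun y s)"
    have "I (\<lambda>s. G (apply_bcontfun x s)) (c t) - I (\<lambda>s. G (apply_bcontfun y s)) (c t) = I ?d (c t)"
      unfolding I_def by (simp add: Henstock_Kurzweil_Integration.integral_diff int Gx)
    moreover have "norm (I ?d (c t)) \<le> 4 * h * (K * dist x y)"
    proof (rule I_bound[OF _ _ c])
      show "norm (?d s) \<le> K * dist x y" for s
        using G_lip mult_left_mono[OF dist_bounded K] order_trans by blast
    qed (intro continuous_intros Gx)
    moreover have "4 * h * K * dist x y \<le> 1 / 2 * dist x y"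
      using h(3) by (intro mult_right_mono) auto
    ultimately show "dist (apply_bcontfun (\<Phi> x) t) (apply_bcontfun (\<Phi> y) t) \<le> 1 / 2 * dist x y"
      by (simp add: \<Phi> dist_norm mult.assoc)
  qed
  then obtain y where y: "\<Phi> y = y"
    using banach_fix_type[of "1/2" \<Phi>] by auto
  define x where "x = apply_bcontfun y"
  define u where "u s = G (x s)" for s
  have u: "continuous_on UNIV u" unfolding u_def x_def by (rule Gx)
  have x: "x t = x0 + I u (c t)" for t using \<Phi>[of y t] unfolding y x_def u_def .
  show ?thesis
  proof (rule that[of h x])
    show "h > 0" by (rule h)
    show "x 0 = x0" using h by (simp add: x c_def I_def)
    show mem: "x t \<in> ?B" if "t \<in> {-h<..<h}" for t
      using I_bound[OF u _ c, of M t] M(2) h(2) by (simp add: x dist_norm u_def)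
    show "(x has_vector_derivative F (x t)) (at t)" if t: "t \<in> {-h<..<h}" for t
    proof -
      have "((\<lambda>t. integral {-h..t} u) has_vector_derivative u t) (at t within {-h..h})"
        using t u by (intro integral_has_vector_derivative) (auto intro: continuous_on_subset)
      then have "((\<lambda>t. integral {-h..t} u) has_vector_derivative u t) (at t)"
        using t at_within_interior[of t "{-h..h}"] by simp
      then have "((\<lambda>t. x0 + I u t) has_vector_derivative u t) (at t)"
        using has_vector_derivative_add[OF has_vector_derivative_const[of "x0 - integral {-h..0} u"]]
        by (fastforce simp: I_def algebra_simps)
      then have "(x has_vector_derivative u t) (at t)"
        by (rule has_vector_derivative_transform_within_open[of _ _ _ "{-h<..<h}"])
          (use t in \<open>auto simp: x c_def\<close>)
      moreover have "u t = F (x t)"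
        using mem[OF t] by (simp add: u_def G_def closest_point_self)
      ultimately show ?thesis by simp
    qed
  qed
qed

text \<open>If the solution is \<open>C\<^sup>m\<close>, then so is its derivative \<open>F (x t)\<close>.\<close>

lemma Ck_on_ode_solution:
  fixes F :: "'a::euclidean_space \<Rightarrow> 'a" and x :: "real \<Rightarrow> 'a"
  assumes "open J" "x ` J \<subseteq> S" and F: "\<And>m. Ck_on m S F"
    and x: "\<And>t. t \<in> J \<Longrightarrow> (x has_vector_derivative F (x t)) (at t)"
  shows "Ck_on m J x"
proof (induction m)
  case 0
  show ?case
    using x by (auto intro!: continuous_at_imp_continuous_on has_vector_derivative_continuous)
next
  case (Suc m)
  show ?case
  proof (rule Ck_on_SucI[OF \<open>open J\<close>])
    show "(x has_derivative (\<lambda>h. h *\<^sub>R F (x t))) (at t)" if "t \<in> J" for t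
      using x[OF that] by (simp add: has_vector_derivative_def)
    show "Ck_on m J (\<lambda>t. v *\<^sub>R F (x t))" for v
      by (intro Ck_on_scaleR Ck_on_const \<open>open J\<close> Ck_on_compose[OF _ \<open>x ` J \<subseteq> S\<close> F Suc])
  qed
qed

text \<open>The set \<open>M\<close> is general because the chord field has a meaning only on a set that need
not be open. Near a time
of agreement, the maximum of the distance between the curves over a short interval is at most half
of itself by the mean value inequality, hence zero.\<close>

lemma ode_solution_unique:
  fixes f :: "'a::real_normed_vector \<Rightarrow> 'a" and x y :: "real \<Rightarrow> 'a" and T :: real
  defines "S \<equiv> {0..<T}"
  assumes lip: "\<And>z. z \<in> M \<Longrightarrow> \<exists>r>0. \<exists>K. K-lipschitz_on (M \<inter> ball z r) f"
    and x: "\<And>t. t \<in> S \<Longrightarrow> x t \<in> M" "\<And>t. t \<in> S \<Longrightarrow> (x has_vector_derivative f (x t)) (at t within S)"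
    and y: "\<And>t. t \<in> S \<Longrightarrow> y t \<in> M" "\<And>t. t \<in> S \<Longrightarrow> (y has_vector_derivative f (y t)) (at t within S)"
    and "x 0 = y 0" "t \<in> S"
  shows "x t = y t"
proof -
  have cont: "continuous_on S x" "continuous_on S y"
    using x(2) y(2) has_vector_derivative_continuous continuous_on_eq_continuous_within by blast+
  let ?A = "{t\<in>S. x t = y t}"
  have "closedin (top_of_set S) {t\<in>S. x t - y t = 0}"
    by (intro continuous_closedin_preimage_constant continuous_intros cont)
  then have "closedin (top_of_set S) ?A" by simp
  moreover have "openin (top_of_set S) ?A"
    unfolding openin_contains_ball
  proof (intro conjI ballI)
    fix a assume "a \<in> ?A"
    then have a: "a \<in> S" "x a = y a" by auto
    obtain r K where r: "r > 0" and K: "K-lipschitz_on (M \<inter> ball (x a) r) f"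
      using lip[OF x(1)[OF a(1)]] by blast
    obtain d1 where d1: "d1 > 0" "\<And>s. s \<in> S \<Longrightarrow> dist s a < d1 \<Longrightarrow> dist (x s) (x a) < r"
      using cont(1) a(1) r unfolding continuous_on_iff by blast
    obtain d2 where d2: "d2 > 0" "\<And>s. s \<in> S \<Longrightarrow> dist s a < d2 \<Longrightarrow> dist (y s) (y a) < r"
      using cont(2) a(1) r unfolding continuous_on_iff by blast
    have K0: "K \<ge> 0" using K by (rule lipschitz_on_nonneg)
    \<comment> \<open>Both curves stay in the ball for twice this time, the interval ends before T, and K d is at most 1/2.\<close>
    define d where "d = Min {d1 / 2, d2 / 2, (T - a) / 2, 1 / (2 * (K + 1))}"
    have "d > 0" using d1 d2 K0 a by (simp add: d_def S_def)
    have d: "d \<le> d1 / 2" "d \<le> d2 / 2" "d \<le> (T - a) / 2" "d \<le> 1 / (2 * (K + 1))"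
      unfolding d_def by (rule Min_le; blast)+
    let ?J = "{max 0 (a - d)..a + d}"
    have J: "?J \<subseteq> S" "a \<in> ?J" using d(3) \<open>d > 0\<close> a(1) by (auto simp: S_def)
    let ?w = "\<lambda>t. x t - y t"
    have "continuous_on ?J (\<lambda>t. norm (?w t))"
      using cont J(1) by (intro continuous_intros) (auto intro: continuous_on_subset)
    then obtain s where s: "s \<in> ?J" and max: "\<And>t. t \<in> ?J \<Longrightarrow> norm (?w t) \<le> norm (?w s)"
      using continuous_attains_sup[of ?J "\<lambda>t. norm (?w t)"] J(2) by auto
    have "norm (?w s - ?w a) \<le> (K * norm (?w s)) * norm (s - a)"
    proof (rule differentiable_bound[of ?J])
      fix t assume t: "t \<in> ?J"
      then have "t \<in> S" using J by blast
      have "dist t a < d1" "dist t a < d2"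
        using t d \<open>d > 0\<close> d1(1) d2(1) by (auto simp: dist_real_def)
      then have "x t \<in> M \<inter> ball (x a) r" "y t \<in> M \<inter> ball (x a) r"
        using d1(2)[OF \<open>t \<in> S\<close>] d2(2)[OF \<open>t \<in> S\<close>] x(1)[OF \<open>t \<in> S\<close>] y(1)[OF \<open>t \<in> S\<close>] a(2)
        by (simp_all add: dist_commute)
      then have "norm (f (x t) - f (y t)) \<le> K * norm (?w t)"
        using lipschitz_onD[OF K] by (simp add: dist_norm)
      also have "\<dots> \<le> K * norm (?w s)" by (intro mult_left_mono max t K0)
      finally show "onorm (\<lambda>h. h *\<^sub>R (f (x t) - f (y t))) \<le> K * norm (?w s)"
        by (intro onorm_le) (simp add: mult.commute[of _ "\<bar>_\<bar>"] mult_left_mono)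
      have "(?w has_vector_derivative f (x t) - f (y t)) (at t within ?J)"
        using x(2) y(2) \<open>t \<in> S\<close> J(1)
        by (intro has_vector_derivative_diff) (auto intro: has_vector_derivative_within_subset)
      then show "(?w has_derivative (\<lambda>h. h *\<^sub>R (f (x t) - f (y t)))) (at t within ?J)"
        by (simp add: has_vector_derivative_def)
    qed (use s J in auto)
    also have "\<dots> \<le> (K * norm (?w s)) * d"
      using s K0 by (intro mult_left_mono) auto
    also have "\<dots> = (K * d) * norm (?w s)" by simp
    also have "\<dots> \<le> 1 / 2 * norm (?w s)"
    proof (rule mult_right_mono)
      have "d * (2 * (K + 1)) \<le> 1" using d(4) K0 by (simp add: field_simps)
      then show "K * d \<le> 1 / 2" using \<open>d > 0\<close> by (simp add: algebra_simps)
    qed simp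
    finally have "norm (?w s) \<le> 0" using a by simp
    then have eq: "x t = y t" if "t \<in> ?J" for t using max[OF that] by simp
    have "ball a d \<inter> S \<subseteq> ?A"
    proof
      fix t assume t: "t \<in> ball a d \<inter> S"
      then have "t \<in> ?J" by (auto simp: S_def dist_real_def)
      with t eq show "t \<in> ?A" by blast
    qed
    with \<open>d > 0\<close> show "\<exists>e>0. ball a e \<inter> S \<subseteq> ?A" by blast
  qed blast
  moreover have "connected S" unfolding S_def by (intro convex_connected convex_real_interval)
  moreover have "0 \<in> ?A" using assms by auto
  ultimately have "?A = S" unfolding connected_clopen by blast
  with \<open>t \<in> S\<close> show ?thesis by blast
qed

section \<open>The chord shortening flow\<close>

lemma smooth_submanifold_slice_chart:
  assumes "smooth_submanifold k \<Sigma>" "p \<in> \<Sigma>"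
  obtains U V \<phi> \<psi> L where "slice_chart \<Sigma> U V \<phi> \<psi> L" "p \<in> U"
  using assms unfolding smooth_submanifold_def slice_chart_def by meson

definition chord_field :: "'a::euclidean_space set \<Rightarrow> 'a \<times> 'a \<Rightarrow> 'a \<times> 'a" where
  "chord_field \<Sigma> = (\<lambda>(p, q).
     (- tangential_part \<Sigma> p (conormal p q), - tangential_part \<Sigma> q (conormal q p)))"

definition chord_ends :: "'a set \<Rightarrow> ('a \<times> 'a) set" where
  "chord_ends \<Sigma> = {(p, q). p \<in> \<Sigma> \<and> q \<in> \<Sigma> \<and> p \<noteq> q}"

text \<open>One chart around each end point. The two are independent: the end points may lie in different components
of \<open>\<Sigma>\<close>, or close together in overlapping charts.\<close>

locale chart_pair =
  c1: slice_chart \<Sigma> U V \<phi> \<psi> L + c2: slice_chart \<Sigma> U' V' \<phi>' \<psi>' L'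
  for \<Sigma> U V :: "'a::euclidean_space set" and \<phi> \<psi> L and U' V' :: "'a set" and \<phi>' \<psi>' L'
begin

definition chord_domain :: "('a \<times> 'a) set" where
  "chord_domain = (U \<times> U') \<inter> {z. fst z \<noteq> snd z}"

text \<open>The smooth extension of \<open>chord_field \<Sigma>\<close> to pairs of points off \<open>\<Sigma>\<close>.\<close>

definition extended_field :: "'a \<times> 'a \<Rightarrow> 'a \<times> 'a" where
  "extended_field z = (- c1.extended_projection (fst z) (conormal (fst z) (snd z)),
     - c2.extended_projection (snd z) (conormal (snd z) (fst z)))"

lemma open_chord_domain: "open chord_domain"
  unfolding chord_domain_def
  by (intro open_Int open_Times c1.open_U c2.open_U open_Collect_neq continuous_intros)

lemma Ck_extended_field: "Ck_on m chord_domain extended_field"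
proof -
  have fst: "Ck_on m chord_domain fst" and snd: "Ck_on m chord_domain snd"
    by (auto intro: Ck_on_linear open_chord_domain bounded_linear_fst bounded_linear_snd)
  have n: "Ck_on m chord_domain (\<lambda>z. (case (f z, g z) of (p, q) \<Rightarrow> conormal p q))"
    if "Ck_on m chord_domain f" "Ck_on m chord_domain g" "\<forall>z\<in>chord_domain. f z \<noteq> g z" for f g :: "'a \<times> 'a \<Rightarrow> 'a"
    by (rule Ck_on_compose[OF open_chord_domain _ Ck_on_conormal Ck_on_Pair[OF open_chord_domain that(1,2)]])
      (use that(3) in auto)
  have ne: "\<forall>z\<in>chord_domain. fst z \<noteq> snd z" "\<forall>z\<in>chord_domain. snd z \<noteq> fst z"
    unfolding chord_domain_def by auto
  have n1: "Ck_on m chord_domain (\<lambda>z. conormal (fst z) (snd z))"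
    using n[OF fst snd] ne by (simp add: case_prod_unfold)
  have n2: "Ck_on m chord_domain (\<lambda>z. conormal (snd z) (fst z))"
    using n[OF snd fst] ne by (simp add: case_prod_unfold)
  have "Ck_on m chord_domain (\<lambda>z. case (fst z, conormal (fst z) (snd z)) of (x, v) \<Rightarrow> c1.extended_projection x v)"
    by (rule Ck_on_compose[OF open_chord_domain _ c1.Ck_extended_projection
          Ck_on_Pair[OF open_chord_domain fst n1]]) (auto simp: chord_domain_def)
  moreover have "Ck_on m chord_domain (\<lambda>z. case (snd z, conormal (snd z) (fst z)) of (x, v) \<Rightarrow> c2.extended_projection x v)"
    by (rule Ck_on_compose[OF open_chord_domain _ c2.Ck_extended_projection
          Ck_on_Pair[OF open_chord_domain snd n2]]) (auto simp: chord_domain_def)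
  ultimately show ?thesis
    unfolding extended_field_def by (intro Ck_on_Pair Ck_on_minus open_chord_domain) simp_all
qed

lemma extended_field_eq_chord_field: "z \<in> chord_domain \<Longrightarrow> z \<in> chord_ends \<Sigma> \<Longrightarrow> extended_field z = chord_field \<Sigma> z"
  by (auto simp: chord_domain_def extended_field_def chord_field_def chord_ends_def
      c1.extended_projection_eq_tangential_part c2.extended_projection_eq_tangential_part)

text \<open>Each end point moves with the velocity \<open>- extended_projection x v\<close> for a vector \<open>v\<close> depending on
the other end point, and this velocity lies in \<open>D\<psi>(\<phi> x) L\<close> whatever \<open>v\<close> is. So each end point stays on \<open>\<Sigma>\<close> separately.\<close>

lemma integral_curve_in_chord_ends:
  assumes J: "convex J" "t0 \<in> J" "z t0 \<in> chord_ends \<Sigma>"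
    and S: "\<And>t. t \<in> J \<Longrightarrow> z t \<in> chord_domain"
    and z: "\<And>t. t \<in> J \<Longrightarrow> (z has_vector_derivative extended_field (z t)) (at t within J)"
    and "t \<in> J"
  shows "z t \<in> chord_ends \<Sigma>"
proof -
  have der: "((\<lambda>t. fst (z t)) has_vector_derivative
      - c1.extended_projection (fst (z t)) (conormal (fst (z t)) (snd (z t)))) (at t within J)"
    "((\<lambda>t. snd (z t)) has_vector_derivative
      - c2.extended_projection (snd (z t)) (conormal (snd (z t)) (fst (z t)))) (at t within J)"
    if "t \<in> J" for t
    using bounded_linear.has_vector_derivative[OF bounded_linear_fst z[OF that]]
      bounded_linear.has_vector_derivative[OF bounded_linear_snd z[OF that]]
    by (simp_all add: extended_field_def)
  have U: "fst (z t) \<in> U" "snd (z t) \<in> U'" "fst (z t) \<noteq> snd (z t)" if "t \<in> J" for t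
    using S[OF that] by (auto simp: chord_domain_def)
  have neg: "- c1.extended_projection x v \<in> c1.D\<psi> (\<phi> x) ` L" if "x \<in> U" for x v
    by (rule subspace_neg[OF linear_subspace_image[OF c1.linear_D\<psi>[OF that] c1.subspace_L] c1.extended_projection_mem[OF that]])
  have neg': "- c2.extended_projection x v \<in> c2.D\<psi> (\<phi>' x) ` L'" if "x \<in> U'" for x v
    by (rule subspace_neg[OF linear_subspace_image[OF c2.linear_D\<psi>[OF that] c2.subspace_L] c2.extended_projection_mem[OF that]])
  have "fst (z t) \<in> \<Sigma>"
    by (rule c1.curve_stays_in[OF J(1,2) _ U(1) der(1) neg[OF U(1)] \<open>t \<in> J\<close>])
      (use J(3) in \<open>auto simp: chord_ends_def\<close>)
  moreover have "snd (z t) \<in> \<Sigma>"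
    by (rule c2.curve_stays_in[OF J(1,2) _ U(2) der(2) neg'[OF U(2)] \<open>t \<in> J\<close>])
      (use J(3) in \<open>auto simp: chord_ends_def\<close>)
  ultimately show ?thesis
    using U(3)[OF \<open>t \<in> J\<close>] by (auto simp: chord_ends_def case_prod_unfold)
qed

end

lemma chart_pair_exists:
  assumes "smooth_submanifold k \<Sigma>" "z \<in> chord_ends \<Sigma>"
  obtains U V \<phi> \<psi> L U' V' \<phi>' \<psi>' L' where "chart_pair \<Sigma> U V \<phi> \<psi> L U' V' \<phi>' \<psi>' L'"
    "z \<in> chart_pair.chord_domain U U'"
proof -
  have z: "fst z \<in> \<Sigma>" "snd z \<in> \<Sigma>" "fst z \<noteq> snd z" using assms(2) by (auto simp: chord_ends_def)
  obtain U V \<phi> \<psi> L where c1: "slice_chart \<Sigma> U V \<phi> \<psi> L" "fst z \<in> U"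
    using smooth_submanifold_slice_chart[OF assms(1) z(1)] .
  obtain U' V' \<phi>' \<psi>' L' where c2: "slice_chart \<Sigma> U' V' \<phi>' \<psi>' L'" "snd z \<in> U'"
    using smooth_submanifold_slice_chart[OF assms(1) z(2)] .
  have pair: "chart_pair \<Sigma> U V \<phi> \<psi> L U' V' \<phi>' \<psi>' L'" using c1 c2 by (simp add: chart_pair_def)
  have "z \<in> chart_pair.chord_domain U U'"
    unfolding chart_pair.chord_domain_def[OF pair] using c1(2) c2(2) z(3) by (simp add: mem_Times_iff)
  with pair show ?thesis by (rule that)
qed

text \<open>The Lipschitz bound is inherited from the smooth extension, which avoids any estimate along \<open>\<Sigma>\<close>
itself.\<close>

lemma chord_field_locally_lipschitz:
  assumes "smooth_submanifold k \<Sigma>" "z \<in> chord_ends \<Sigma>"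
  shows "\<exists>r>0. \<exists>K. K-lipschitz_on (chord_ends \<Sigma> \<inter> ball z r) (chord_field \<Sigma>)"
proof -
  obtain U V \<phi> \<psi> L U' V' \<phi>' \<psi>' L' where c: "chart_pair \<Sigma> U V \<phi> \<psi> L U' V' \<phi>' \<psi>' L'"
    and z: "z \<in> chart_pair.chord_domain U U'"
    using chart_pair_exists[OF assms] .
  interpret chart_pair \<Sigma> U V \<phi> \<psi> L U' V' \<phi>' \<psi>' L' by (rule c)
  obtain r K where r: "r > 0" "cball z r \<subseteq> chord_domain" "K-lipschitz_on (cball z r) extended_field"
    using Ck_on_locally_lipschitz[OF open_chord_domain z Ck_extended_field] .
  have "K-lipschitz_on (chord_ends \<Sigma> \<inter> ball z r) extended_field"
    by (rule lipschitz_on_subset[OF r(3)]) auto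
  then have "K-lipschitz_on (chord_ends \<Sigma> \<inter> ball z r) (chord_field \<Sigma>)"
    using lipschitz_on_transform[of K _ extended_field "chord_field \<Sigma>"] extended_field_eq_chord_field r(2)
    by (metis (no_types, lifting) IntD1 IntD2 ball_subset_cball subsetD)
  with r(1) show ?thesis by blast
qed

lemma chord_shortening_flow_ends:
  assumes "chord_shortening_flow \<Sigma> T C" "t \<in> {0..<T}"
  shows "(C 0 t, C 1 t) \<in> chord_ends \<Sigma>"
    and "((\<lambda>t. (C 0 t, C 1 t)) has_vector_derivative chord_field \<Sigma> (C 0 t, C 1 t))
      (at t within {0..<T})"
    and "u \<in> {0..1} \<Longrightarrow> C u t = linepath (C 0 t) (C 1 t) u"
proof -
  have C: "C 0 t \<in> \<Sigma>" "C 1 t \<in> \<Sigma>" "chord_between (C 0 t) (C 1 t) (\<lambda>u. C u t)"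
    "(C 0 has_vector_derivative - tangential_part \<Sigma> (C 0 t) (conormal (C 0 t) (C 1 t)))
      (at t within {0..<T})"
    "(C 1 has_vector_derivative - tangential_part \<Sigma> (C 1 t) (conormal (C 1 t) (C 0 t)))
      (at t within {0..<T})"
    using assms unfolding chord_shortening_flow_def by blast+
  show "(C 0 t, C 1 t) \<in> chord_ends \<Sigma>" "u \<in> {0..1} \<Longrightarrow> C u t = linepath (C 0 t) (C 1 t) u"
    using C(1-3) unfolding chord_ends_def chord_between_def by blast+
  show "((\<lambda>t. (C 0 t, C 1 t)) has_vector_derivative chord_field \<Sigma> (C 0 t, C 1 t))
      (at t within {0..<T})"
    using has_vector_derivative_Pair[OF C(4,5)] by (simp add: chord_field_def)
qed

text \<open>The solution of the extended equation takes values on \<open>\<Sigma>\<close>, where the extension is the true field.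
Smoothness up to time 0 holds because the solution extends to negative times.\<close>

lemma chord_shortening_flow_exists:
  fixes \<Sigma> :: "'a::euclidean_space set"
  assumes "smooth_submanifold k \<Sigma>" "(p, q) \<in> chord_ends \<Sigma>"
  obtains \<epsilon> C where "\<epsilon> > 0" "chord_shortening_flow \<Sigma> \<epsilon> C" "\<And>u. C u 0 = linepath p q u"
proof -
  obtain U V \<phi> \<psi> L U' V' \<phi>' \<psi>' L' where c: "chart_pair \<Sigma> U V \<phi> \<psi> L U' V' \<phi>' \<psi>' L'"
    and pq: "(p, q) \<in> chart_pair.chord_domain U U'"
    using chart_pair_exists[OF assms] .
  interpret chart_pair \<Sigma> U V \<phi> \<psi> L U' V' \<phi>' \<psi>' L' by (rule c)
  obtain r K where r: "r > 0" "cball (p, q) r \<subseteq> chord_domain" "K-lipschitz_on (cball (p, q) r) extended_field"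
    using Ck_on_locally_lipschitz[OF open_chord_domain pq Ck_extended_field] .
  obtain h z where h: "h > 0" and z0: "z 0 = (p, q)"
    and mem: "\<And>t. t \<in> {-h<..<h} \<Longrightarrow> z t \<in> cball (p, q) r"
    and z: "\<And>t. t \<in> {-h<..<h} \<Longrightarrow> (z has_vector_derivative extended_field (z t)) (at t)"
    using picard_lindelof_existence[OF r(1,3)] by blast
  let ?J = "{-h<..<h}"
  have S: "z t \<in> chord_domain" if "t \<in> ?J" for t using mem[OF that] r(2) by blast
  have ends: "z t \<in> chord_ends \<Sigma>" if "t \<in> ?J" for t
    by (rule integral_curve_in_chord_ends[of ?J 0 z])
      (use h z0 assms(2) S z that in \<open>auto intro: has_vector_derivative_at_within\<close>)
  have field: "(z has_vector_derivative chord_field \<Sigma> (z t)) (at t within J)" if "t \<in> ?J" for t J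
    using z[OF that] extended_field_eq_chord_field[OF S[OF that] ends[OF that]]
    by (simp add: has_vector_derivative_at_within)
  have Ck_z: "Ck_on m ?J z" for m
    by (rule Ck_on_ode_solution[OF _ _ Ck_extended_field z]) (use S in auto)
  define C where "C u t = linepath (fst (z t)) (snd (z t)) u" for u t
  have C01: "C 0 = (\<lambda>t. fst (z t))" "C 1 = (\<lambda>t. snd (z t))"
    by (auto simp: C_def linepath_def)
  let ?W = "(UNIV :: real set) \<times> ?J"
  have W: "open ?W" by (intro open_Times) auto
  have "Ck_on m ?W (\<lambda>w. C (fst w) (snd w))" for m
  proof -
    have zs: "Ck_on m ?W (\<lambda>w. z (snd w))"
      by (rule Ck_on_compose[OF W _ Ck_z Ck_on_linear[OF bounded_linear_snd W]]) auto
    show ?thesis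
      unfolding C_def linepath_def
      by (intro Ck_on_add Ck_on_scaleR Ck_on_diff Ck_on_const W Ck_on_linear[OF bounded_linear_fst W]
          Ck_on_bounded_linear[OF bounded_linear_fst W zs] Ck_on_bounded_linear[OF bounded_linear_snd W zs])
  qed
  then have "smooth_on ({0..1} \<times> {0..<h}) (\<lambda>(u, t). C u t)"
    unfolding smooth_on_def using W h
    by (intro ballI exI[of _ ?W] exI[of _ "\<lambda>w. C (fst w) (snd w)"]) auto
  moreover have "C 0 t \<in> \<Sigma> \<and> C 1 t \<in> \<Sigma> \<and> chord_between (C 0 t) (C 1 t) (\<lambda>u. C u t) \<and>
      (C 0 has_vector_derivative - tangential_part \<Sigma> (C 0 t) (conormal (C 0 t) (C 1 t)))
        (at t within {0..<h}) \<and>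
      (C 1 has_vector_derivative - tangential_part \<Sigma> (C 1 t) (conormal (C 1 t) (C 0 t)))
        (at t within {0..<h})" if "t \<in> {0..<h}" for t
  proof -
    have t: "t \<in> ?J" using that h by auto
    show ?thesis
      unfolding C01 chord_between_def
      using ends[OF t] bounded_linear.has_vector_derivative[OF bounded_linear_fst field[OF t]]
        bounded_linear.has_vector_derivative[OF bounded_linear_snd field[OF t]]
      by (auto simp: chord_ends_def chord_field_def C_def case_prod_unfold)
  qed
  ultimately have "chord_shortening_flow \<Sigma> h C"
    unfolding chord_shortening_flow_def by blast
  then show ?thesis
    by (rule that[OF h]) (simp add: C_def z0)
qed

lemma chord_shortening_flow_unique:
  fixes \<Sigma> :: "'a::euclidean_space set"
  assumes "smooth_submanifold k \<Sigma>"
    and C: "chord_shortening_flow \<Sigma> T C" "chord_shortening_flow \<Sigma> T' C'"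
    and init: "C 0 0 = C' 0 0" "C 1 0 = C' 1 0"
    and "u \<in> {0..1}" and t: "t \<in> {0..<min T T'}"
  shows "C u t = C' u t"
proof -
  let ?I = "{0..<min T T'}"
  have sub: "?I \<subseteq> {0..<T}" "?I \<subseteq> {0..<T'}" by auto
  have "(C 0 t, C 1 t) = (C' 0 t, C' 1 t)"
  proof (rule ode_solution_unique[where M = "chord_ends \<Sigma>" and f = "chord_field \<Sigma>" and T = "min T T'"
        and x = "\<lambda>t. (C 0 t, C 1 t)" and y = "\<lambda>t. (C' 0 t, C' 1 t)"])
    fix s assume "s \<in> ?I"
    then have s: "s \<in> {0..<T}" "s \<in> {0..<T'}" by auto
    show "(C 0 s, C 1 s) \<in> chord_ends \<Sigma>" "(C' 0 s, C' 1 s) \<in> chord_ends \<Sigma>"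
      using chord_shortening_flow_ends(1) C s by blast+
    show "((\<lambda>t. (C 0 t, C 1 t)) has_vector_derivative chord_field \<Sigma> (C 0 s, C 1 s)) (at s within ?I)"
      by (rule has_vector_derivative_within_subset[OF chord_shortening_flow_ends(2)[OF C(1) s(1)] sub(1)])
    show "((\<lambda>t. (C' 0 t, C' 1 t)) has_vector_derivative chord_field \<Sigma> (C' 0 s, C' 1 s)) (at s within ?I)"
      by (rule has_vector_derivative_within_subset[OF chord_shortening_flow_ends(2)[OF C(2) s(2)] sub(2)])
  qed (use t init chord_field_locally_lipschitz[OF assms(1)] in auto)
  moreover have "C u t = linepath (C 0 t) (C 1 t) u" "C' u t = linepath (C' 0 t) (C' 1 t) u"
    using chord_shortening_flow_ends(3) C t sub \<open>u \<in> {0..1}\<close> by blast+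
  ultimately show ?thesis by simp
qed

theorem proposition2p7:
  fixes \<Sigma> :: "(real ^ 'n) set" and k :: nat and C\<^sub>0 :: "real \<Rightarrow> real ^ 'n"
  assumes "smooth_submanifold k \<Sigma>"
    and "chord C\<^sub>0"
    and "C\<^sub>0 ` {0, 1} \<subseteq> \<Sigma>"
  shows "(\<exists>\<epsilon>>0. \<exists>C. chord_shortening_flow \<Sigma> \<epsilon> C \<and> (\<forall>u\<in>{0..1}. C u 0 = C\<^sub>0 u)) \<and>
    (\<forall>T\<^sub>1>0. \<forall>T\<^sub>2>0. \<forall>C\<^sub>1 C\<^sub>2.
       chord_shortening_flow \<Sigma> T\<^sub>1 C\<^sub>1 \<and> (\<forall>u\<in>{0..1}. C\<^sub>1 u 0 = C\<^sub>0 u) \<and>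
       chord_shortening_flow \<Sigma> T\<^sub>2 C\<^sub>2 \<and> (\<forall>u\<in>{0..1}. C\<^sub>2 u 0 = C\<^sub>0 u) \<longrightarrow>
       (\<forall>u\<in>{0..1}. \<forall>t\<in>{0..<min T\<^sub>1 T\<^sub>2}. C\<^sub>1 u t = C\<^sub>2 u t))"
proof (intro conjI allI impI ballI)
  obtain p q where "p \<noteq> q" and C0: "\<And>u. u \<in> {0..1} \<Longrightarrow> C\<^sub>0 u = linepath p q u"
    using \<open>chord C\<^sub>0\<close> unfolding chord_def chord_between_def by blast
  then have "(p, q) \<in> chord_ends \<Sigma>"
    using C0[of 0] C0[of 1] assms(3) by (simp add: chord_ends_def linepath_def)
  from chord_shortening_flow_exists[OF assms(1) this] C0
  show "\<exists>\<epsilon>>0. \<exists>C. chord_shortening_flow \<Sigma> \<epsilon> C \<and> (\<forall>u\<in>{0..1}. C u 0 = C\<^sub>0 u)"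
    by metis
next
  fix T\<^sub>1 T\<^sub>2 C\<^sub>1 C\<^sub>2 u t
  assume flows: "chord_shortening_flow \<Sigma> T\<^sub>1 C\<^sub>1 \<and> (\<forall>u\<in>{0..1}. C\<^sub>1 u 0 = C\<^sub>0 u) \<and>
    chord_shortening_flow \<Sigma> T\<^sub>2 C\<^sub>2 \<and> (\<forall>u\<in>{0..1}. C\<^sub>2 u 0 = C\<^sub>0 u)"
    and "u \<in> {0..1::real}" "t \<in> {0..<min T\<^sub>1 T\<^sub>2}"
  have "C\<^sub>1 0 0 = C\<^sub>2 0 0" "C\<^sub>1 1 0 = C\<^sub>2 1 0"
    using flows by simp_all
  with flows show "C\<^sub>1 u t = C\<^sub>2 u t"
    using chord_shortening_flow_unique[OF assms(1)] \<open>u \<in> {0..1}\<close> \<open>t \<in> {0..<min T\<^sub>1 T\<^sub>2}\<close> by blast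
qed

end
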